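(* Let $\alpha,\beta\in\mathbb{R}$. Define $w_{\alpha,\beta}:\mathbb{N}\to\mathbb{R}$ by $w_{\alpha,\beta}(1):=1+2^{\alpha}-2^{\alpha+\beta}$ and, for $n\ge 2$, $$w_{\alpha,\beta}(n):=n^{\alpha}\left[1+\Big(1+\frac1n\Big)^{\alpha}-\Big(1-\frac1n\Big)^{\beta}-\Big(1+\frac1n\Big)^{\alpha+\beta}\right].$$ Then for every finitely supported function $u:\mathbb{N}_0\to\mathbb{R}$ with $u(0)=0$, $$\sum_{n=1}^\infty |u(n)-u(n-1)|^2 n^\alpha \;\ge\; \sum_{n=1}^\infty w_{\alpha,\beta}(n)\,|u(n)|^2 .$$
   Context: $\mathbb{N}_0=\{0,1,2,\dots\}$ and $\mathbb{N}=\{1,2,\dots\}$. *)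

theory Defs
  imports "HOL-Analysis.Infinite_Sum"
begin

text \<open>
  The weight is meant on the positive integers only; the value at 0 is irrelevant.
\<close>

definition hardy_weight :: "real \<Rightarrow> real \<Rightarrow> nat \<Rightarrow> real" where
  "hardy_weight \<alpha> \<beta> n =
     (if n = 1 then 1 + 2 powr \<alpha> - 2 powr (\<alpha> + \<beta>)
      else real n powr \<alpha> *
        (1 + (1 + 1 / real n) powr \<alpha> - (1 - 1 / real n) powr \<beta> - (1 + 1 / real n) powr (\<alpha> + \<beta>)))"

end

(* The sequence g n = n powr \<beta> acts as a ground state: weighting the product 2 x y in (x - y)^2 by the
   ratio g (n - 1) / g n bounds the energy of each edge {n - 1, n} below by a combination of
   (u n)^2 and (u (n - 1))^2, and the coefficients collected at a vertex n add up to the weight. *)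
theory Submission
  imports Defs
begin

text \<open>The gap between the two sides is \<open>(t * x - y)\<^sup>2 / t\<close>, so equality
  holds exactly when \<open>y = t * x\<close>.\<close>

lemma weighted_square_diff_ge:
  fixes x y t :: real
  assumes "t > 0"
  shows "(x - y)\<^sup>2 \<ge> (1 - t) * x\<^sup>2 + (1 - 1 / t) * y\<^sup>2"
proof -
  have "(x - y)\<^sup>2 - ((1 - t) * x\<^sup>2 + (1 - 1 / t) * y\<^sup>2) = (t * x - y)\<^sup>2 / t"
    using assms by (simp add: field_simps power2_eq_square)
  also have "\<dots> \<ge> 0"
    using assms by simp
  finally show ?thesis
    by simp
qed

text \<open>Splits the weight at n into the shares of the edges {n - 1, n} and {n, n + 1}. The
  separate value at n = 1 fits the same formula because \<open>0 powr \<beta> = 0\<close>.\<close>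

lemma hardy_weight_eq:
  assumes "n \<ge> 1"
  shows "hardy_weight \<alpha> \<beta> n = real n powr \<alpha> * (1 - (1 - 1 / real n) powr \<beta>)
           + real (Suc n) powr \<alpha> * (1 - (1 + 1 / real n) powr \<beta>)"
proof -
  have "real (Suc n) = real n * (1 + 1 / real n)"
    using assms by (simp add: field_simps)
  then have "real (Suc n) powr \<alpha> = real n powr \<alpha> * (1 + 1 / real n) powr \<alpha>"
    by (metis powr_mult)
  then show ?thesis
    by (simp add: hardy_weight_def powr_add algebra_simps)
qed

lemma edge_energy_ge:
  fixes u :: "nat \<Rightarrow> real"
  assumes "u 0 = 0"
  shows "(u (Suc n) - u n)\<^sup>2 * real (Suc n) powr \<alpha>
           \<ge> real (Suc n) powr \<alpha> * (1 - (1 - 1 / real (Suc n)) powr \<beta>) * (u (Suc n))\<^sup>2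
             + real (Suc n) powr \<alpha> * (1 - (1 + 1 / real n) powr \<beta>) * (u n)\<^sup>2"
proof (cases "n = 0")
  case True
  \<comment> \<open>Here t would be 0, so the quadratic bound does not apply; with
    \<open>u 0 = 0\<close> and \<open>0 powr \<beta> = 0\<close> both sides equal
    \<open>(u 1)\<^sup>2\<close>.\<close>
  then show ?thesis
    using assms by simp
next
  case False
  \<comment> \<open>This is the ground state ratio g n / g (n + 1), since 1 - 1 / (n + 1) = n / (n +
    1).\<close>
  define t where "t = (1 - 1 / real (Suc n)) powr \<beta>"
  have "1 - 1 / real (Suc n) = inverse (1 + 1 / real n)"
    using False by (simp add: field_simps)
  then have "1 / t = (1 + 1 / real n) powr \<beta>"
    unfolding t_def by (simp add: powr_minus_divide inverse_eq_divide powr_divide)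
  moreover have "t > 0"
    using False by (simp add: t_def)
  ultimately have
    "(u (Suc n) - u n)\<^sup>2 \<ge> (1 - t) * (u (Suc n))\<^sup>2 + (1 - (1 + 1 / real n) powr \<beta>) * (u n)\<^sup>2"
    using weighted_square_diff_ge by metis
  then have "real (Suc n) powr \<alpha> * (u (Suc n) - u n)\<^sup>2 \<ge> real (Suc n) powr \<alpha> *
      ((1 - t) * (u (Suc n))\<^sup>2 + (1 - (1 + 1 / real n) powr \<beta>) * (u n)\<^sup>2)"
    by (rule mult_left_mono) simp
  then show ?thesis
    unfolding t_def by (simp only: distrib_left mult.assoc mult.commute[of "(_)\<^sup>2" "_ powr \<alpha>"])
qed

(* The subtracted term is the share of the vertex N that belongs to the missing edge {N, N + 1}. *)
lemma partial_hardy_ineq: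
  fixes u :: "nat \<Rightarrow> real"
  assumes "u 0 = 0"
  shows "(\<Sum>n=1..N. (u n - u (n - 1))\<^sup>2 * real n powr \<alpha>)
           \<ge> (\<Sum>n=1..N. hardy_weight \<alpha> \<beta> n * (u n)\<^sup>2)
             - real (Suc N) powr \<alpha> * (1 - (1 + 1 / real N) powr \<beta>) * (u N)\<^sup>2"
proof (induction N)
  case 0
  then show ?case
    using assms by simp
next
  case (Suc N)
  \<comment> \<open>The first share joins the term subtracted at N to form the bound for the edge
    {N, N + 1}; the second becomes the term subtracted at N + 1.\<close>
  have "hardy_weight \<alpha> \<beta> (Suc N) * (u (Suc N))\<^sup>2
      = real (Suc N) powr \<alpha> * (1 - (1 - 1 / real (Suc N)) powr \<beta>) * (u (Suc N))\<^sup>2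
        + real (Suc (Suc N)) powr \<alpha> * (1 - (1 + 1 / real (Suc N)) powr \<beta>) * (u (Suc N))\<^sup>2"
    by (subst hardy_weight_eq) (simp, rule distrib_right)
  moreover have "{1..Suc N} = insert (Suc N) {1..N}"
    by auto
  ultimately show ?case
    using Suc.IH edge_energy_ge[of u N \<alpha> \<beta>, OF assms] by simp
qed

theorem theorem2p1:
  fixes \<alpha> \<beta> :: real and u :: "nat \<Rightarrow> real"
  assumes "finite {n. u n \<noteq> 0}"
    and "u 0 = 0"
  shows "(\<Sum>\<^sub>\<infinity>n\<in>{1..}. \<bar>u n - u (n - 1)\<bar>\<^sup>2 * real n powr \<alpha>)
           \<ge> (\<Sum>\<^sub>\<infinity>n\<in>{1..}. hardy_weight \<alpha> \<beta> n * \<bar>u n\<bar>\<^sup>2)"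
proof -
  obtain M where "\<forall>n\<in>{n. u n \<noteq> 0}. n < M"
    using assms(1) finite_nat_set_iff_bounded by blast
  then have zero: "u n = 0" if "n \<ge> M" for n
    using that by force
  \<comment> \<open>The cutoff includes M because the energy term at n = M still involves
    \<open>u (M - 1)\<close>; beyond M both summands vanish.\<close>
  have infsum_eq: "(\<Sum>\<^sub>\<infinity>n\<in>{1..}. f n) = (\<Sum>n=1..M. f n)"
    if "\<And>n. n > M \<Longrightarrow> f n = 0" for f :: "nat \<Rightarrow> real"
  proof -
    have "(\<Sum>\<^sub>\<infinity>n\<in>{1..}. f n) = (\<Sum>\<^sub>\<infinity>n\<in>{1..M}. f n)"
      using that by (intro infsum_cong_neutral) auto
    then show ?thesis
      by simp
  qed
  \<comment> \<open>Since \<open>u M = 0\<close>, the boundary term at M disappears.\<close>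
  have "(\<Sum>n=1..M. hardy_weight \<alpha> \<beta> n * (u n)\<^sup>2)
      \<le> (\<Sum>n=1..M. (u n - u (n - 1))\<^sup>2 * real n powr \<alpha>)"
    using partial_hardy_ineq[where N = M and u = u and \<alpha> = \<alpha> and \<beta> = \<beta>] assms(2) zero[of M] by simp
  then show ?thesis
    by (subst (1 2) infsum_eq) (simp_all add: zero)
qed

end
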